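(* Let $f:\mathbb{R}^n\to\mathbb{R}$ be twice differentiable and suppose there are constants $0<m<M<\infty$ such that $\nabla^2 f(x)\succeq mI$ and $\|\nabla^2 f(x)-\nabla^2 f(y)\|\le M\|x-y\|$ for all $x,y\in\mathbb{R}^n$. Let $x^*$ be the minimizer of $f$ on $\mathbb{R}^n$, let $x_0\in\mathbb{R}^n$ be a starting point, and let $L>0$ be such that $\|\nabla^2 f(x)\|\le L$ for all $x$ in the sublevel set $\mathcal{L}_0=\{x\in\mathbb{R}^n: f(x)\le f(x_0)\}$. Let $\delta=\frac{2}{3}\frac{m}{M}$ and let the accuracy parameter $\varepsilon$ satisfy $0<\varepsilon<\delta$ and $\varepsilon<m^2L^{-1}$. Then the damped Newton's method (DNM) started at $x_0$ takes at most $$N_0=9\,\frac{L^2M^2}{m^5}\,\bigl(f(x_0)-f(x^* )\bigr)$$ steps to find a point $x\in B(x^*,\delta)$.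
   Context: $\|\cdot\|$ is the Euclidean norm (and the induced operator norm for matrices), $(\cdot,\cdot)$ is the Euclidean inner product, $A\succeq B$ means that $A-B$ is positive semidefinite, and $B(x^*,\delta)=\{x\in\mathbb{R}^n:\|x-x^*\|\le\delta\}$. Newton's direction at $x$ is $n(x)=-(\nabla^2 f(x))^{-1}\nabla f(x)$, and Newton's decrement is $\lambda(x)=\bigl((\nabla^2 f(x))^{-1}\nabla f(x),\nabla f(x)\bigr)^{1/2}$. The damped Newton's method (DNM), with parameters $m,L,\varepsilon$ and starting point $x_0$: set $x:=x_0$ and then 1. compute $n(x)$; 2. if $f(x+n(x))\le f(x)+0.5(\nabla f(x),n(x))$, set $t(x):=1$; otherwise set $t(x):=m(2L)^{-1}$; 3. set $x:=x+t(x)n(x)$; 4. if $\lambda(x)\le\varepsilon^{1.5}$, stop and output $x$ as the approximation of $x^*$; otherwise go to 1. One DNM step is one pass through 1.–3. *)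

theory Defs
  imports "HOL-Analysis.Analysis"
begin

definition grad :: "(real ^ 'n \<Rightarrow> real) \<Rightarrow> real ^ 'n \<Rightarrow> real ^ 'n" where
  "grad f x = (THE g. GDERIV f x :> g)"

definition hessian :: "(real ^ 'n \<Rightarrow> real) \<Rightarrow> real ^ 'n \<Rightarrow> real ^ 'n ^ 'n" where
  "hessian f x = jacobian (grad f) (at x)"

definition twice_differentiable :: "(real ^ 'n \<Rightarrow> real) \<Rightarrow> bool" where
  "twice_differentiable f \<longleftrightarrow>
     (\<forall>x. f differentiable (at x)) \<and> (\<forall>x. grad f differentiable (at x))"

(* The library norm on real ^ 'n ^ 'n is the Frobenius norm, not the operator norm. *)
definition op_norm :: "real ^ 'n ^ 'm \<Rightarrow> real" where
  "op_norm A = onorm ((*v) A)"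

(* Symmetry of A - B is not part of the relation: Hessians of twice (Frechet) differentiable
   functions are symmetric anyway. *)
definition loewner_ge :: "real ^ 'n ^ 'n \<Rightarrow> real ^ 'n ^ 'n \<Rightarrow> bool" (infix "\<succeq>" 50) where
  "A \<succeq> B \<longleftrightarrow> (\<forall>v. 0 \<le> ((A - B) *v v) \<bullet> v)"

definition newton_dir :: "(real ^ 'n \<Rightarrow> real) \<Rightarrow> real ^ 'n \<Rightarrow> real ^ 'n" where
  "newton_dir f x = - (matrix_inv (hessian f x) *v grad f x)"

definition newton_decrement :: "(real ^ 'n \<Rightarrow> real) \<Rightarrow> real ^ 'n \<Rightarrow> real" where
  "newton_decrement f x = sqrt ((matrix_inv (hessian f x) *v grad f x) \<bullet> grad f x)"

definition dnm_step_size :: "(real ^ 'n \<Rightarrow> real) \<Rightarrow> real \<Rightarrow> real \<Rightarrow> real ^ 'n \<Rightarrow> real" where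
  "dnm_step_size f m L x =
     (if f (x + newton_dir f x) \<le> f x + 0.5 * (grad f x \<bullet> newton_dir f x) then 1
      else m / (2 * L))"

definition dnm_step :: "(real ^ 'n \<Rightarrow> real) \<Rightarrow> real \<Rightarrow> real \<Rightarrow> real ^ 'n \<Rightarrow> real ^ 'n" where
  "dnm_step f m L x = x + dnm_step_size f m L x *\<^sub>R newton_dir f x"

(* dnm f m L \<epsilon> x0 k x: the method started at x0 performs at least k steps and its current point
   after the k-th one is x.  The stopping test comes after the update, hence it is applied to the
   new point, and it is not applied to x0. *)
inductive dnm :: "(real ^ 'n \<Rightarrow> real) \<Rightarrow> real \<Rightarrow> real \<Rightarrow> real \<Rightarrow> real ^ 'n \<Rightarrow> nat \<Rightarrow> real ^ 'n \<Rightarrow> bool"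
  for f m L \<epsilon> x0 where
  start: "dnm f m L \<epsilon> x0 0 x0"
| step: "dnm f m L \<epsilon> x0 k x \<Longrightarrow> k = 0 \<or> \<not> newton_decrement f x \<le> \<epsilon> powr 1.5 \<Longrightarrow>
    dnm f m L \<epsilon> x0 (Suc k) (dnm_step f m L x)"

end

theory Submission
  imports Defs
begin

text \<open>
  Outside the ball the method decreases \<open>f\<close> by a fixed amount per step, and \<open>f\<close> cannot decrease by
  more than \<open>f x0 - f xstar\<close> in total; the quotient of these two quantities bounds the number of
  steps.

  The decrease of one step is at least \<open>3 m \<lambda>\<^sup>2 / (8 L)\<close>, with \<open>\<lambda>\<close> the Newton decrement
  (\<open>dnm_step_decrease\<close>). For a full step this is the acceptance test. For a damped step it is a
  second-order Taylor bound along the Newton direction; the bound \<open>L\<close> on the Hessian is only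
  available in the sublevel set, so the trial point must be shown to lie there, which is a
  one-dimensional convexity argument (\<open>taylor_upper_bound_sublevel\<close>). In turn \<open>\<lambda>\<close> is bounded
  below by the distance to the minimizer, \<open>L \<lambda>\<^sup>2 \<ge> \<parallel>grad f x\<parallel>\<^sup>2 \<ge> m\<^sup>2 \<parallel>x - xstar\<parallel>\<^sup>2\<close>
  (\<open>distance_le_newton_decrement\<close>). For \<open>\<parallel>x - xstar\<parallel> > 2 m / (3 M)\<close> the two estimates together
  give a decrease of at least \<open>m\<^sup>5 / (6 L\<^sup>2 M\<^sup>2)\<close>, which is more than \<open>m\<^sup>5 / (9 L\<^sup>2 M\<^sup>2)\<close>.

  The same lower bound on \<open>\<lambda>\<close> shows that the stopping test cannot end the method too early:
  \<open>\<lambda> \<le> \<epsilon> powr 1.5\<close> and \<open>\<epsilon> < m\<^sup>2 / L\<close> force \<open>\<parallel>x - xstar\<parallel> < \<epsilon> < \<delta>\<close>.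

  The estimate \<open>\<parallel>grad f x\<parallel>\<^sup>2 \<le> L \<lambda>\<^sup>2\<close> rests on the symmetry of the Hessian, which is proved here
  from its Lipschitz continuity by the classical second-difference argument
  (\<open>hessian_symmetric\<close>).
\<close>

section \<open>Positive definite matrices\<close>

lemma norm_matrix_vector_le_op_norm: "norm (A *v v) \<le> op_norm A * norm v"
  for A :: "real ^ 'n ^ 'm"
  unfolding op_norm_def by (rule onorm) simp

lemma quadratic_form_le_op_norm: "(A *v v) \<bullet> v \<le> op_norm A * (norm v)\<^sup>2"
  for A :: "real ^ 'n ^ 'n"
proof -
  have "(A *v v) \<bullet> v \<le> norm (A *v v) * norm v"
    by (rule norm_cauchy_schwarz)
  also have "\<dots> \<le> op_norm A * norm v * norm v"
    by (intro mult_right_mono norm_matrix_vector_le_op_norm) simp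
  finally show ?thesis by (simp add: power2_eq_square mult.assoc)
qed

lemma loewner_ge_mat_iff:
  "A \<succeq> m *\<^sub>R mat 1 \<longleftrightarrow> (\<forall>v. m * (norm v)\<^sup>2 \<le> (A *v v) \<bullet> v)"
  by (simp add: loewner_ge_def matrix_vector_mult_diff_rdistrib inner_diff_left
      scaleR_matrix_vector_assoc[symmetric] power2_norm_eq_inner)

lemma loewner_ge_mat_imp_nonneg:
  assumes "0 \<le> m" and "A \<succeq> m *\<^sub>R mat 1"
  shows "0 \<le> (A *v v) \<bullet> v"
proof -
  have "0 \<le> m * (norm v)\<^sup>2"
    using assms(1) by simp
  also have "\<dots> \<le> (A *v v) \<bullet> v"
    using assms(2) by (simp add: loewner_ge_mat_iff)
  finally show ?thesis .
qed

lemma loewner_ge_mat_le_op_norm: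
  fixes A :: "real ^ 'n ^ 'n"
  assumes "A \<succeq> m *\<^sub>R mat 1"
  shows "m \<le> op_norm A"
proof -
  obtain b :: "real ^ 'n" where "norm b = 1"
    using vector_choose_size[of 1] by auto
  then show ?thesis
    using assms[unfolded loewner_ge_mat_iff, rule_format, of b] quadratic_form_le_op_norm[of A b]
    by simp
qed

lemma loewner_ge_mat_imp_invertible:
  fixes A :: "real ^ 'n ^ 'n"
  assumes "0 < m" and "A \<succeq> m *\<^sub>R mat 1"
  shows "invertible A"
proof -
  have "v = 0" if "A *v v = 0" for v
  proof -
    have "m * (norm v)\<^sup>2 \<le> 0"
      using assms(2) that by (metis loewner_ge_mat_iff inner_zero_left)
    then show ?thesis
      using assms(1) by (simp add: mult_le_0_iff)
  qed
  then show ?thesis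
    by (metis invertible_left_inverse matrix_left_invertible_ker)
qed

text \<open>
  This is the Cauchy-Schwarz inequality for the form \<open>(A u, w)\<close> at \<open>w = A u\<close>, combined with
  \<open>(A w, w) \<le> L \<parallel>w\<parallel>\<^sup>2\<close>. Symmetry is essential: a rotation of the plane by an acute angle is positive
  definite and violates the inequality with \<open>L = 1\<close>.
\<close>
lemma norm_matrix_vector_square_le:
  fixes A :: "real ^ 'n ^ 'n"
  assumes sym: "\<And>u v. (A *v u) \<bullet> v = (A *v v) \<bullet> u"
    and psd: "\<And>v. 0 \<le> (A *v v) \<bullet> v"
    and L: "0 < L" "op_norm A \<le> L"
  shows "(norm (A *v u))\<^sup>2 \<le> L * ((A *v u) \<bullet> u)"
proof -
  define w where "w = A *v u"
  \<comment> \<open>The factor \<open>s = 1 / L\<close> minimizes \<open>(w, u) - 2 s \<parallel>w\<parallel>\<^sup>2 + s\<^sup>2 L \<parallel>w\<parallel>\<^sup>2\<close>, which bounds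
    \<open>(A (u - s w), u - s w)\<close> from above.\<close>
  have "0 \<le> (A *v (u - (1 / L) *\<^sub>R w)) \<bullet> (u - (1 / L) *\<^sub>R w)"
    by (rule psd)
  also have "\<dots> = w \<bullet> u - 2 / L * (w \<bullet> w) + (1 / L)\<^sup>2 * ((A *v w) \<bullet> w)"
    using sym[of w u] L(1)
    by (simp add: matrix_vector_mult_diff_distrib matrix_vector_mult_scaleR inner_diff_left
        inner_diff_right w_def[symmetric] power2_eq_square) (simp add: field_simps)
  also have "(1 / L)\<^sup>2 * ((A *v w) \<bullet> w) \<le> (1 / L)\<^sup>2 * (L * (w \<bullet> w))"
    using quadratic_form_le_op_norm[of A w] mult_right_mono[OF L(2), of "(norm w)\<^sup>2"]
    by (intro mult_left_mono) (auto simp: power2_norm_eq_inner)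
  also have "w \<bullet> u - 2 / L * (w \<bullet> w) + (1 / L)\<^sup>2 * (L * (w \<bullet> w)) = w \<bullet> u - (w \<bullet> w) / L"
    using L(1) by (simp add: field_simps power2_eq_square)
  finally show ?thesis
    using L(1) by (simp add: w_def[symmetric] power2_norm_eq_inner field_simps)
qed

section \<open>Derivatives along lines\<close>

lemma grad_has_derivative:
  fixes f :: "real ^ 'n \<Rightarrow> real"
  assumes "f differentiable (at x)"
  shows "(f has_derivative (\<lambda>h. h \<bullet> grad f x)) (at x)"
proof -
  let ?D = "frechet_derivative f (at x)"
  have D: "(f has_derivative ?D) (at x)"
    using assms frechet_derivative_works by blast
  interpret linear ?D
    using D has_derivative_linear by blast
  define g where "g = (\<Sum>b\<in>Basis. ?D b *\<^sub>R b)"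
  have "?D h = h \<bullet> g" for h
  proof -
    have "?D h = ?D (\<Sum>b\<in>Basis. (h \<bullet> b) *\<^sub>R b)"
      by (simp add: euclidean_representation)
    also have "\<dots> = h \<bullet> g"
      by (simp add: sum scale g_def inner_sum_right mult.commute)
    finally show ?thesis .
  qed
  then have "GDERIV f x :> g"
    using D unfolding gderiv_def by (metis (no_types, lifting) ext)
  moreover have "g' = g" if "GDERIV f x :> g'" for g'
  proof -
    have "(\<lambda>h. h \<bullet> g') = (\<lambda>h. h \<bullet> g)"
      using that \<open>GDERIV f x :> g\<close> unfolding gderiv_def by (rule has_derivative_unique)
    then have "(g' - g) \<bullet> g' = (g' - g) \<bullet> g"
      by metis
    then show ?thesis
      by (metis eq_iff_diff_eq_0 inner_diff_right inner_eq_zero_iff)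
  qed
  ultimately have "GDERIV f x :> grad f x"
    unfolding grad_def by (rule theI)
  then show ?thesis
    by (simp add: gderiv_def)
qed

lemma hessian_has_derivative:
  fixes f :: "real ^ 'n \<Rightarrow> real"
  assumes "twice_differentiable f"
  shows "(grad f has_derivative (*v) (hessian f x)) (at x)"
  using assms unfolding twice_differentiable_def hessian_def jacobian_works by blast

lemma DERIV_along_line:
  fixes f :: "real ^ 'n \<Rightarrow> real"
  assumes "twice_differentiable f"
  shows "DERIV (\<lambda>s. f (x + s *\<^sub>R u)) s :> grad f (x + s *\<^sub>R u) \<bullet> u"
proof -
  have "(f has_derivative (\<lambda>h. h \<bullet> grad f (x + s *\<^sub>R u))) (at (x + s *\<^sub>R u))"
    using assms grad_has_derivative unfolding twice_differentiable_def by blast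
  moreover have "((\<lambda>s. x + s *\<^sub>R u) has_derivative (\<lambda>h. h *\<^sub>R u)) (at s)"
    by (auto intro!: derivative_eq_intros)
  ultimately have "((\<lambda>s. f (x + s *\<^sub>R u)) has_derivative
      (\<lambda>h. (h *\<^sub>R u) \<bullet> grad f (x + s *\<^sub>R u))) (at s)"
    by (rule has_derivative_compose[rotated])
  then show ?thesis
    by (simp add: has_field_derivative_def inner_commute mult.commute[of _ "u \<bullet> _"]
        mult_commute_abs)
qed

lemma DERIV_grad_along_line:
  fixes f :: "real ^ 'n \<Rightarrow> real"
  assumes "twice_differentiable f"
  shows "DERIV (\<lambda>s. grad f (x + s *\<^sub>R u) \<bullet> v) s :> (hessian f (x + s *\<^sub>R u) *v u) \<bullet> v"
proof -
  have "((\<lambda>s. x + s *\<^sub>R u) has_derivative (\<lambda>h. h *\<^sub>R u)) (at s)"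
    by (auto intro!: derivative_eq_intros)
  then have "((\<lambda>s. grad f (x + s *\<^sub>R u)) has_derivative
      (\<lambda>h. hessian f (x + s *\<^sub>R u) *v (h *\<^sub>R u))) (at s)"
    using hessian_has_derivative[OF assms] by (rule has_derivative_compose)
  then have "((\<lambda>s. grad f (x + s *\<^sub>R u) \<bullet> v) has_derivative
      (\<lambda>h. (hessian f (x + s *\<^sub>R u) *v (h *\<^sub>R u)) \<bullet> v)) (at s)"
    by (rule has_derivative_inner_left)
  then show ?thesis
    by (simp add: has_field_derivative_def matrix_vector_mult_scaleR mult_commute_abs)
qed

section \<open>Symmetry of the Hessian\<close>

text \<open>Two applications of the mean value theorem, first in the direction \<open>u\<close>, then in \<open>v\<close>.\<close>
lemma second_difference_eq_hessian:
  fixes f :: "real ^ 'n \<Rightarrow> real"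
  assumes f: "twice_differentiable f" and t: "0 < t"
  obtains y where "norm (y - x) \<le> t * (norm u + norm v)"
    and "f (x + t *\<^sub>R u + t *\<^sub>R v) - f (x + t *\<^sub>R u) - f (x + t *\<^sub>R v) + f x
      = t\<^sup>2 * ((hessian f y *v v) \<bullet> u)"
proof -
  define \<psi> where "\<psi> s = f ((x + t *\<^sub>R v) + s *\<^sub>R u) - f (x + s *\<^sub>R u)" for s
  have d\<psi>: "DERIV \<psi> s :> grad f ((x + t *\<^sub>R v) + s *\<^sub>R u) \<bullet> u - grad f (x + s *\<^sub>R u) \<bullet> u" for s
    unfolding \<psi>_def by (intro DERIV_diff DERIV_along_line f)
  obtain a where a: "0 < a" "a < t"
    and \<psi>: "\<psi> t - \<psi> 0 = t * (grad f ((x + t *\<^sub>R v) + a *\<^sub>R u) \<bullet> u - grad f (x + a *\<^sub>R u) \<bullet> u)"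
    using MVT2[OF t d\<psi>] unfolding diff_zero by blast
  define \<eta> where "\<eta> s = grad f ((x + a *\<^sub>R u) + s *\<^sub>R v) \<bullet> u" for s
  have d\<eta>: "DERIV \<eta> s :> (hessian f ((x + a *\<^sub>R u) + s *\<^sub>R v) *v v) \<bullet> u" for s
    unfolding \<eta>_def by (rule DERIV_grad_along_line[OF f])
  obtain b where b: "0 < b" "b < t"
    and \<eta>: "\<eta> t - \<eta> 0 = t * ((hessian f ((x + a *\<^sub>R u) + b *\<^sub>R v) *v v) \<bullet> u)"
    using MVT2[OF t d\<eta>] unfolding diff_zero by blast
  let ?y = "(x + a *\<^sub>R u) + b *\<^sub>R v"
  have "norm (?y - x) \<le> a * norm u + b * norm v"
    using a b norm_triangle_ineq[of "a *\<^sub>R u" "b *\<^sub>R v"] by (simp add: algebra_simps)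
  also have "\<dots> \<le> t * (norm u + norm v)"
    using a b by (simp add: distrib_left add_mono mult_right_mono)
  finally have "norm (?y - x) \<le> t * (norm u + norm v)" .
  moreover have "f (x + t *\<^sub>R u + t *\<^sub>R v) - f (x + t *\<^sub>R u) - f (x + t *\<^sub>R v) + f x = \<psi> t - \<psi> 0"
    by (simp add: \<psi>_def algebra_simps)
  moreover have "\<psi> t - \<psi> 0 = t * (\<eta> t - \<eta> 0)"
    unfolding \<psi> by (simp add: \<eta>_def algebra_simps)
  ultimately show ?thesis
    using that[of ?y] \<eta> by (simp add: power2_eq_square)
qed

text \<open>
  The second difference is symmetric in \<open>u\<close> and \<open>v\<close>, so the two mixed derivatives, taken at points
  at distance \<open>O(t)\<close> from \<open>x\<close>, agree; let \<open>t\<close> tend to \<open>0\<close>.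
\<close>
lemma hessian_symmetric:
  fixes f :: "real ^ 'n \<Rightarrow> real"
  assumes f: "twice_differentiable f" and M: "0 \<le> M"
    and lip: "\<And>x y. op_norm (hessian f x - hessian f y) \<le> M * norm (x - y)"
  shows "(hessian f x *v u) \<bullet> v = (hessian f x *v v) \<bullet> u"
proof -
  define C where "C = 2 * M * (norm u + norm v) * norm u * norm v"
  have close: "\<bar>(hessian f y *v a) \<bullet> b - (hessian f x *v a) \<bullet> b\<bar>
      \<le> M * (t * (norm u + norm v)) * norm a * norm b"
    if "norm (y - x) \<le> t * (norm u + norm v)" for y t a b
  proof -
    have "\<bar>(hessian f y *v a) \<bullet> b - (hessian f x *v a) \<bullet> b\<bar>
        = \<bar>((hessian f y - hessian f x) *v a) \<bullet> b\<bar>"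
      by (simp add: matrix_vector_mult_diff_rdistrib inner_diff_left)
    also have "\<dots> \<le> norm ((hessian f y - hessian f x) *v a) * norm b"
      by (rule Cauchy_Schwarz_ineq2)
    also have "\<dots> \<le> op_norm (hessian f y - hessian f x) * norm a * norm b"
      by (intro mult_right_mono norm_matrix_vector_le_op_norm) simp
    also have "\<dots> \<le> M * (t * (norm u + norm v)) * norm a * norm b"
      using lip[of y x] mult_left_mono[OF that M] by (intro mult_right_mono) auto
    finally show ?thesis .
  qed
  let ?d = "\<bar>(hessian f x *v u) \<bullet> v - (hessian f x *v v) \<bullet> u\<bar>"
  have bound: "?d \<le> t * C" if t: "0 < t" for t
  proof -
    obtain y where y: "norm (y - x) \<le> t * (norm u + norm v)"
      "f (x + t *\<^sub>R u + t *\<^sub>R v) - f (x + t *\<^sub>R u) - f (x + t *\<^sub>R v) + f x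
        = t\<^sup>2 * ((hessian f y *v v) \<bullet> u)"
      by (rule second_difference_eq_hessian[OF f t])
    obtain z where z: "norm (z - x) \<le> t * (norm v + norm u)"
      "f (x + t *\<^sub>R v + t *\<^sub>R u) - f (x + t *\<^sub>R v) - f (x + t *\<^sub>R u) + f x
        = t\<^sup>2 * ((hessian f z *v u) \<bullet> v)"
      by (rule second_difference_eq_hessian[OF f t])
    have "t\<^sup>2 * ((hessian f y *v v) \<bullet> u) = t\<^sup>2 * ((hessian f z *v u) \<bullet> v)"
      unfolding y(2)[symmetric] z(2)[symmetric] by (simp add: add_ac)
    then have "(hessian f y *v v) \<bullet> u = (hessian f z *v u) \<bullet> v"
      using t by simp
    then show ?thesis
      using close[OF y(1), of v u] close[of z t u v] z(1)
      by (simp add: C_def algebra_simps)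
  qed
  have "?d \<le> 0"
  proof (rule tendsto_lowerbound)
    show "((\<lambda>t. t * C) \<longlongrightarrow> 0) (at_right 0)"
      by (auto intro!: tendsto_eq_intros)
    show "eventually (\<lambda>t. ?d \<le> t * C) (at_right 0)"
      using bound by (simp add: eventually_at_right_less eventually_at_filter)
  qed simp
  then show ?thesis by simp
qed

section \<open>Growth of the gradient away from the minimizer\<close>

lemma grad_eq_0_at_minimizer:
  fixes f :: "real ^ 'n \<Rightarrow> real"
  assumes "f differentiable (at xstar)" and "is_arg_min f (\<lambda>x. True) xstar"
  shows "grad f xstar = 0"
proof -
  have "(\<lambda>h. h \<bullet> grad f xstar) = (\<lambda>h. 0)"
    by (rule differential_zero_maxmin[OF _ open_UNIV grad_has_derivative[OF assms(1)]])
      (use assms(2) in \<open>auto simp: is_arg_min_def not_less\<close>)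
  then show ?thesis
    by (metis inner_eq_zero_iff)
qed

text \<open>
  The mean value theorem for \<open>s \<mapsto> (grad f (xstar + s u), u)\<close> with \<open>u = x - xstar\<close> gives
  \<open>m \<parallel>u\<parallel>\<^sup>2 \<le> (grad f x, u)\<close>.
\<close>
lemma norm_grad_ge:
  fixes f :: "real ^ 'n \<Rightarrow> real"
  assumes f: "twice_differentiable f"
    and convex: "\<And>x. hessian f x \<succeq> m *\<^sub>R mat 1"
    and min: "is_arg_min f (\<lambda>x. True) xstar"
  shows "m * norm (x - xstar) \<le> norm (grad f x)"
proof (cases "x = xstar")
  case False
  let ?u = "x - xstar"
  have "grad f xstar = 0"
    using f min grad_eq_0_at_minimizer unfolding twice_differentiable_def by blast
  moreover obtain z where "grad f (xstar + 1 *\<^sub>R ?u) \<bullet> ?u - grad f (xstar + 0 *\<^sub>R ?u) \<bullet> ?u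
      = (1 - 0) * ((hessian f (xstar + z *\<^sub>R ?u) *v ?u) \<bullet> ?u)"
    using MVT2[OF zero_less_one DERIV_grad_along_line[OF f, of xstar ?u ?u]] by blast
  ultimately have "m * (norm ?u)\<^sup>2 \<le> grad f x \<bullet> ?u"
    using convex by (simp add: loewner_ge_mat_iff)
  also have "\<dots> \<le> norm (grad f x) * norm ?u"
    by (rule norm_cauchy_schwarz)
  finally show ?thesis
    using False by (simp add: power2_eq_square mult.assoc[symmetric])
qed simp

section \<open>The Newton decrement\<close>

lemma newton_dir_properties:
  fixes f :: "real ^ 'n \<Rightarrow> real"
  assumes m: "0 < m" and convex: "hessian f x \<succeq> m *\<^sub>R mat 1"
  shows newton_decrement_nonneg: "0 \<le> newton_decrement f x"
    and hessian_newton_dir: "hessian f x *v newton_dir f x = - grad f x"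
    and newton_decrement_square:
      "(newton_decrement f x)\<^sup>2 = (hessian f x *v newton_dir f x) \<bullet> newton_dir f x"
    and grad_inner_newton_dir: "grad f x \<bullet> newton_dir f x = - (newton_decrement f x)\<^sup>2"
proof -
  let ?H = "hessian f x"
  have "?H ** matrix_inv ?H = mat 1"
    using loewner_ge_mat_imp_invertible[OF assms]
    unfolding matrix_inv_def invertible_def by (rule someI2_ex) blast
  then have "?H *v (matrix_inv ?H *v grad f x) = grad f x"
    by (simp add: matrix_vector_mul_assoc)
  then show H: "?H *v newton_dir f x = - grad f x"
    using matrix_vector_mult_diff_distrib[of ?H 0 "matrix_inv ?H *v grad f x"]
    by (simp add: newton_dir_def)
  have form: "(matrix_inv ?H *v grad f x) \<bullet> grad f x = (?H *v newton_dir f x) \<bullet> newton_dir f x"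
    unfolding H by (simp add: newton_dir_def inner_commute)
  have nonneg: "0 \<le> (?H *v newton_dir f x) \<bullet> newton_dir f x"
    using m by (intro loewner_ge_mat_imp_nonneg[OF _ convex]) simp
  show "0 \<le> newton_decrement f x"
    using form nonneg by (simp add: newton_decrement_def)
  show decr: "(newton_decrement f x)\<^sup>2 = (?H *v newton_dir f x) \<bullet> newton_dir f x"
    using form nonneg by (simp add: newton_decrement_def)
  show "grad f x \<bullet> newton_dir f x = - (newton_decrement f x)\<^sup>2"
    unfolding decr H by simp
qed

text \<open>
  With \<open>n\<close> the Newton direction and \<open>H\<close> the Hessian, \<open>\<parallel>grad f x\<parallel>\<^sup>2 = \<parallel>H n\<parallel>\<^sup>2 \<le> L (H n, n) = L \<lambda>\<^sup>2\<close>.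
\<close>
lemma distance_le_newton_decrement:
  fixes f :: "real ^ 'n \<Rightarrow> real"
  assumes f: "twice_differentiable f" and m: "0 < m"
    and convex: "\<And>x. hessian f x \<succeq> m *\<^sub>R mat 1"
    and sym: "\<And>u v. (hessian f x *v u) \<bullet> v = (hessian f x *v v) \<bullet> u"
    and min: "is_arg_min f (\<lambda>x. True) xstar"
    and L: "0 < L" "op_norm (hessian f x) \<le> L"
  shows "m\<^sup>2 * (norm (x - xstar))\<^sup>2 \<le> L * (newton_decrement f x)\<^sup>2"
proof -
  have psd: "0 \<le> (hessian f x *v v) \<bullet> v" for v
    using m by (intro loewner_ge_mat_imp_nonneg[OF _ convex]) simp
  have "(m * norm (x - xstar))\<^sup>2 \<le> (norm (grad f x))\<^sup>2"
    using m by (intro power_mono norm_grad_ge[OF f convex min]) auto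
  also have "\<dots> = (norm (hessian f x *v newton_dir f x))\<^sup>2"
    by (simp add: hessian_newton_dir[OF m convex])
  also have "\<dots> \<le> L * (newton_decrement f x)\<^sup>2"
    unfolding newton_decrement_square[OF m convex]
    by (rule norm_matrix_vector_square_le[OF sym psd L])
  finally show ?thesis
    by (simp add: power_mult_distrib)
qed

section \<open>Decrease of the objective in one step\<close>

text \<open>
  The curvature bound \<open>C\<close> holds only where \<open>\<phi> s \<le> \<phi> 0\<close>. If the step \<open>t\<close> left this set, then \<open>\<phi>\<close>,
  being initially decreasing, would return to the value \<open>\<phi> 0\<close> at some \<open>b \<in> (0, t)\<close>. By convexity the
  bound holds on all of \<open>[0, b]\<close>, and Taylor's formula there contradicts \<open>\<phi> b = \<phi> 0\<close>, because
  \<open>b\<close> is too short.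
\<close>
lemma taylor_upper_bound_sublevel:
  fixes \<phi> \<phi>' \<phi>'' :: "real \<Rightarrow> real"
  assumes d1: "\<And>s. DERIV \<phi> s :> \<phi>' s" and d2: "\<And>s. DERIV \<phi>' s :> \<phi>'' s"
    and nonneg: "\<And>s. 0 \<le> \<phi>'' s"
    and bound: "\<And>s. \<phi> s \<le> \<phi> 0 \<Longrightarrow> \<phi>'' s \<le> C"
    and t: "0 < t" "t * C < - 2 * \<phi>' 0" and descent: "\<phi>' 0 < 0"
  shows "\<phi> t \<le> \<phi> 0 + t * \<phi>' 0 + C / 2 * t\<^sup>2"
proof -
  have convex: "convex_on UNIV \<phi>"
    by (rule f''_ge0_imp_convex[OF _ d1 d2 nonneg]) simp
  have taylor: "\<phi> b \<le> \<phi> 0 + b * \<phi>' 0 + C / 2 * b\<^sup>2" if b: "0 < b" "\<phi> b \<le> \<phi> 0" for b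
  proof -
    define D where "D k = (if k = 0 then \<phi> else if k = Suc 0 then \<phi>' else \<phi>'')" for k :: nat
    have "\<exists>s. 0 < s \<and> s < b \<and> \<phi> b = (\<Sum>k<2. D k 0 / fact k * b ^ k) + D 2 s / fact 2 * b ^ 2"
    proof (rule Maclaurin)
      show "\<forall>k s. k < 2 \<and> 0 \<le> s \<and> s \<le> b \<longrightarrow> DERIV (D k) s :> D (Suc k) s"
        using d1 d2 by (auto simp: D_def less_2_cases_iff)
    qed (use b in \<open>auto simp: D_def\<close>)
    then obtain s where s: "0 < s" "s < b" and eq: "\<phi> b = \<phi> 0 + b * \<phi>' 0 + \<phi>'' s / 2 * b\<^sup>2"
      by (auto simp: D_def numeral_2_eq_2 mult.commute)
    have "\<phi> ((1 - s / b) *\<^sub>R 0 + (s / b) *\<^sub>R b) \<le> (1 - s / b) * \<phi> 0 + (s / b) * \<phi> b"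
      by (rule convex_onD[OF convex]) (use s in auto)
    also have "\<dots> \<le> (1 - s / b) * \<phi> 0 + (s / b) * \<phi> 0"
      using s b by (intro add_left_mono mult_left_mono) auto
    finally have "\<phi> s \<le> \<phi> 0"
      using b by (simp add: algebra_simps)
    then have "\<phi>'' s / 2 * b\<^sup>2 \<le> C / 2 * b\<^sup>2"
      by (intro mult_right_mono divide_right_mono bound) auto
    then show ?thesis
      using eq by simp
  qed
  have "\<phi> t \<le> \<phi> 0"
  proof (rule ccontr)
    assume out: "\<not> \<phi> t \<le> \<phi> 0"
    obtain d where d: "0 < d" "\<And>h. 0 < h \<Longrightarrow> h < d \<Longrightarrow> \<phi> (0 + h) < \<phi> 0"
      using DERIV_neg_dec_right[OF d1 descent] by auto
    define r where "r = min (d / 2) t"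
    have r: "0 < r" "r \<le> t" "\<phi> r < \<phi> 0"
      using d(1) d(2)[of r] t(1) by (auto simp: r_def)
    obtain b where b: "r \<le> b" "b \<le> t" "\<phi> b = \<phi> 0"
      using IVT'[of \<phi> r "\<phi> 0" t] r out d1 by (metis DERIV_continuous_on DERIV_subset less_imp_le linear subset_UNIV)
    have "0 \<le> b * (\<phi>' 0 + C / 2 * b)"
      using taylor[of b] r b by (simp add: algebra_simps power2_eq_square)
    moreover have "0 < b"
      using r b by simp
    ultimately have "0 \<le> \<phi>' 0 + C / 2 * b"
      by (simp only: zero_le_mult_iff) linarith
    then have "- 2 * \<phi>' 0 \<le> b * C"
      by (simp add: algebra_simps)
    also have "\<dots> \<le> t * C"
      using b nonneg[of 0] bound[of 0] by (intro mult_right_mono) auto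
    finally show False
      using t by simp
  qed
  then show ?thesis
    using taylor t by simp
qed

text \<open>
  For the damped step the Taylor bound is used with curvature \<open>L \<parallel>n\<parallel>\<^sup>2 \<le> L \<lambda>\<^sup>2 / m\<close> and slope \<open>-\<lambda>\<^sup>2\<close>;
  at \<open>t = m / (2 L)\<close> it amounts to a decrease of \<open>t \<lambda>\<^sup>2 - t\<^sup>2 L \<lambda>\<^sup>2 / (2 m) = (1/2 - 1/8) m \<lambda>\<^sup>2 / L\<close>.
\<close>
lemma dnm_step_decrease:
  fixes f :: "real ^ 'n \<Rightarrow> real"
  assumes f: "twice_differentiable f" and m: "0 < m"
    and convex: "\<And>x. hessian f x \<succeq> m *\<^sub>R mat 1"
    and L: "0 < L" "\<And>y. f y \<le> f x \<Longrightarrow> op_norm (hessian f y) \<le> L"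
  shows "f (dnm_step f m L x) \<le> f x - 3 / 8 * (m / L) * (newton_decrement f x)\<^sup>2"
proof (cases "f (x + newton_dir f x) \<le> f x + 0.5 * (grad f x \<bullet> newton_dir f x)")
  case True
  have "m \<le> L"
    using loewner_ge_mat_le_op_norm[OF convex[of x]] L(2)[of x] by simp
  then have "3 / 8 * (m / L) * (newton_decrement f x)\<^sup>2 \<le> 0.5 * (newton_decrement f x)\<^sup>2"
    using L(1) by (intro mult_right_mono) (auto simp: field_simps)
  then show ?thesis
    using True grad_inner_newton_dir[OF m convex, of x]
    by (simp add: dnm_step_def dnm_step_size_def)
next
  case False
  let ?n = "newton_dir f x" and ?l = "(newton_decrement f x)\<^sup>2"
  define t where "t = m / (2 * L)"
  have step: "dnm_step f m L x = x + t *\<^sub>R ?n"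
    using False by (simp add: dnm_step_def dnm_step_size_def t_def)
  have n: "m * (norm ?n)\<^sup>2 \<le> ?l"
    using convex newton_decrement_square[OF m convex, of x] by (simp add: loewner_ge_mat_iff)
  \<comment> \<open>A zero Newton direction passes the acceptance test.\<close>
  have "?n \<noteq> 0"
    using False by auto
  then have l: "0 < ?l"
    using n m by (smt (verit) mult_pos_pos zero_less_norm_iff zero_less_power)
  have "f (x + t *\<^sub>R ?n) \<le> f (x + 0 *\<^sub>R ?n) + t * (grad f (x + 0 *\<^sub>R ?n) \<bullet> ?n)
      + (L * (norm ?n)\<^sup>2) / 2 * t\<^sup>2"
  proof (rule taylor_upper_bound_sublevel[where \<phi> = "\<lambda>s. f (x + s *\<^sub>R ?n)",
        OF DERIV_along_line[OF f] DERIV_grad_along_line[OF f]])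
    show "0 \<le> (hessian f (x + s *\<^sub>R ?n) *v ?n) \<bullet> ?n" for s
      using m by (intro loewner_ge_mat_imp_nonneg[OF _ convex]) simp
    show "(hessian f (x + s *\<^sub>R ?n) *v ?n) \<bullet> ?n \<le> L * (norm ?n)\<^sup>2"
      if "f (x + s *\<^sub>R ?n) \<le> f (x + 0 *\<^sub>R ?n)" for s
      using quadratic_form_le_op_norm[of "hessian f (x + s *\<^sub>R ?n)" ?n]
        mult_right_mono[OF L(2), of "x + s *\<^sub>R ?n" "(norm ?n)\<^sup>2"] that by simp
    show "0 < t"
      using m L by (simp add: t_def)
    have "t * (L * (norm ?n)\<^sup>2) = m * (norm ?n)\<^sup>2 / 2"
      using L by (simp add: t_def)
    also have "\<dots> \<le> ?l / 2"
      using n by simp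
    also have "\<dots> < 2 * ?l"
      using l by linarith
    finally show "t * (L * (norm ?n)\<^sup>2) < - 2 * (grad f (x + 0 *\<^sub>R ?n) \<bullet> ?n)"
      by (simp add: grad_inner_newton_dir[OF m convex])
    show "grad f (x + 0 *\<^sub>R ?n) \<bullet> ?n < 0"
      using l grad_inner_newton_dir[OF m convex, of x] by simp
  qed
  also have "\<dots> = f x - t * ?l + t / 4 * (m * (norm ?n)\<^sup>2)"
    using L grad_inner_newton_dir[OF m convex, of x]
    by (simp add: t_def power2_eq_square)
  also have "\<dots> \<le> f x - t * ?l + t / 4 * ?l"
    using m L n by (intro add_left_mono mult_left_mono) (auto simp: t_def)
  also have "\<dots> = f x - 3 / 8 * (m / L) * ?l"
    by (simp add: t_def)
  finally show ?thesis
    unfolding step .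
qed

section \<open>Counting the steps\<close>

text \<open>
  The bound \<open>N0\<close> need not be an integer. If no iterate of index at most \<open>N0\<close> lies in the ball, then
  each of them is followed by another step, which again decreases \<open>f\<close> by \<open>\<Delta>\<close>; the iterate with the
  first index above \<open>N0\<close> would then have a value below the minimum.
\<close>
theorem theorem5p1:
  fixes f :: "real ^ 'n \<Rightarrow> real"
    and m M L \<delta> \<epsilon> N0 :: real
    and x0 xstar :: "real ^ 'n"
  assumes "twice_differentiable f"
    and "0 < m" and "m < M"
    and "\<And>x. hessian f x \<succeq> m *\<^sub>R mat 1"
    and "\<And>x y. op_norm (hessian f x - hessian f y) \<le> M * norm (x - y)"
    and "is_arg_min f (\<lambda>x. True) xstar"
    and "0 < L"
    and "\<And>x. f x \<le> f x0 \<Longrightarrow> op_norm (hessian f x) \<le> L"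
    and "\<delta> = 2 / 3 * (m / M)"
    and "0 < \<epsilon>" and "\<epsilon> < \<delta>" and "\<epsilon> < m\<^sup>2 / L"
    and "N0 = 9 * (L\<^sup>2 * M\<^sup>2 / m ^ 5) * (f x0 - f xstar)"
  shows "\<exists>k x. real k \<le> N0 \<and> dnm f m L \<epsilon> x0 k x \<and> x \<in> cball xstar \<delta>"
proof (rule ccontr)
  assume none: "\<nexists>k x. real k \<le> N0 \<and> dnm f m L \<epsilon> x0 k x \<and> x \<in> cball xstar \<delta>"
  have M: "0 < M"
    using assms(2,3) by simp
  have sym: "(hessian f x *v u) \<bullet> v = (hessian f x *v v) \<bullet> u" for x u v
    using M by (intro hessian_symmetric[OF assms(1) _ assms(5)]) simp
  have min: "f xstar \<le> f x" for x
    using assms(6) by (auto simp: is_arg_min_def not_less)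
  \<comment> \<open>The guaranteed decrease per step, chosen such that \<open>N0\<close> is the initial gap \<open>f x0 - f xstar\<close> over \<open>\<Delta>\<close>.\<close>
  define \<Delta> where "\<Delta> = m ^ 5 / (9 * (L\<^sup>2 * M\<^sup>2))"
  have \<Delta>: "0 < \<Delta>"
    using assms(2,7) M by (simp add: \<Delta>_def)
  have N0: "N0 = (f x0 - f xstar) / \<Delta>"
    using assms(2,7,13) M by (simp add: \<Delta>_def)
  have dist_le: "m\<^sup>2 * (norm (x - xstar))\<^sup>2 \<le> L * (newton_decrement f x)\<^sup>2" if "f x \<le> f x0" for x
    by (rule distance_le_newton_decrement[OF assms(1,2,4) sym assms(6,7) assms(8)[OF that]])

  have decrease: "f (dnm_step f m L x) \<le> f x - \<Delta>" if "f x \<le> f x0" "x \<notin> cball xstar \<delta>" for x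
  proof -
    have "\<delta> < norm (x - xstar)"
      using that(2) by (simp add: dist_norm norm_minus_commute)
    then have "\<delta>\<^sup>2 \<le> (norm (x - xstar))\<^sup>2"
      using assms(10,11) by (intro power_mono) auto
    then have "m\<^sup>2 * \<delta>\<^sup>2 \<le> m\<^sup>2 * (norm (x - xstar))\<^sup>2"
      by (intro mult_left_mono) auto
    also have "\<dots> \<le> L * (newton_decrement f x)\<^sup>2"
      by (rule dist_le[OF that(1)])
    finally have "m\<^sup>2 * \<delta>\<^sup>2 / L \<le> (newton_decrement f x)\<^sup>2"
      using assms(7) by (simp add: field_simps)
    then have "3 / 8 * (m / L) * (m\<^sup>2 * \<delta>\<^sup>2 / L) \<le> 3 / 8 * (m / L) * (newton_decrement f x)\<^sup>2"
      using assms(2,7) by (intro mult_left_mono) auto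
    moreover have "3 / 8 * (m / L) * (m\<^sup>2 * \<delta>\<^sup>2 / L) = 3 / 2 * \<Delta>"
      using assms(7) M by (simp add: \<Delta>_def assms(9) field_simps eval_nat_numeral)
    moreover have "f (dnm_step f m L x) \<le> f x - 3 / 8 * (m / L) * (newton_decrement f x)\<^sup>2"
      using assms(8) that(1) by (intro dnm_step_decrease[OF assms(1,2,4,7)]) auto
    ultimately show ?thesis
      using \<Delta> by linarith
  qed

  have not_stopped: "\<not> newton_decrement f x \<le> \<epsilon> powr 1.5"
    if "f x \<le> f x0" "x \<notin> cball xstar \<delta>" for x
  proof
    assume stop: "newton_decrement f x \<le> \<epsilon> powr 1.5"
    have "0 \<le> newton_decrement f x"
      by (rule newton_decrement_nonneg[OF assms(2,4)])
    then have "(newton_decrement f x)\<^sup>2 \<le> (\<epsilon> powr 1.5)\<^sup>2"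
      using stop by (intro power_mono) auto
    also have "\<dots> = \<epsilon> ^ 3"
      using assms(10) by (simp add: powr_power powr_numeral)
    finally have "m\<^sup>2 * (norm (x - xstar))\<^sup>2 \<le> L * \<epsilon> ^ 3"
      using dist_le[OF that(1)] assms(7) by (smt (verit) mult_left_mono)
    also have "\<dots> = (L * \<epsilon>) * \<epsilon>\<^sup>2"
      by (simp add: eval_nat_numeral)
    also have "\<dots> \<le> m\<^sup>2 * \<epsilon>\<^sup>2"
      using assms(7,12) by (intro mult_right_mono) (auto simp: field_simps)
    finally have "norm (x - xstar) \<le> \<epsilon>"
      using assms(2,10) by simp
    then show False
      using that(2) assms(11) by (simp add: dist_norm norm_minus_commute)
  qed

  have run: "\<exists>x. dnm f m L \<epsilon> x0 k x \<and> k * \<Delta> \<le> f x0 - f x" for k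
  proof (induction k)
    case 0
    show ?case
      using dnm.start by fastforce
  next
    case (Suc k)
    then obtain x where x: "dnm f m L \<epsilon> x0 k x" "k * \<Delta> \<le> f x0 - f x"
      by blast
    have "k * \<Delta> \<le> f x0 - f xstar"
      using x(2) min[of x] by simp
    then have "real k \<le> N0"
      using \<Delta> by (simp add: N0 field_simps)
    then have out: "x \<notin> cball xstar \<delta>"
      using none x(1) by blast
    have "0 \<le> k * \<Delta>"
      using \<Delta> by simp
    then have level: "f x \<le> f x0"
      using x(2) by simp
    have "dnm f m L \<epsilon> x0 (Suc k) (dnm_step f m L x)"
      using dnm.step[OF x(1)] not_stopped[OF level out] by blast
    moreover have "Suc k * \<Delta> \<le> f x0 - f (dnm_step f m L x)"
      using x(2) decrease[OF level out] by (simp add: algebra_simps)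
    ultimately show ?case
      by blast
  qed
  obtain k where "N0 < real k"
    using reals_Archimedean2 by blast
  moreover obtain x where "k * \<Delta> \<le> f x0 - f x"
    using run by blast
  then have "real k \<le> N0"
    using \<Delta> min[of x] by (simp add: N0 field_simps)
  ultimately show False
    by simp
qed

end
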